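(* For $s\in(0,\tfrac18)$ put $\bar r(a)=\frac{1-2a+\sqrt{4a^2-4a+9}}{4}$ with $a=1-\sqrt{2s}$. There exists $s_0\in(0,\tfrac18)$ such that for every $s\in[s_0,\tfrac18)$ and every $r\in(0,\bar r(a))$, a platform maximizing the advertising fee $\pi_1-\pi_2$ has an incentive to allocate a positive part $r_s$ of the return cost $r$ to consumers; that is, starting from the equilibrium at $r_s=0$ and moving along equilibria that vary continuously with $r_s$, there is some $r_s\in(0,r]$ (with $s+r_s<\tfrac18$) at which $\pi_1-\pi_2$ is strictly larger than at $r_s=0$.
   Context: Two firms sell one product each at zero marginal cost. Consumers (unit mass) have match values $u_1,u_2$, i.i.d. uniform on $[0,1]$. Firm 1 is prominent (searched and bought first, at no search cost); searching and buying product 2 costs $s$. Each returned unit generates a total return cost $r$, of which the consumer bears $r_s\ge 0$ and the firm bears $r-r_s\ge0$. Then the consumer's return cost acts as additional search cost and changes the outside option from $0$ to $-r_s$. In what follows $a=a(r_s)=1-\sqrt{2(s+r_s)}$ with $s+r_s\in(0,1/8)$; a consumer buys product 2 iff $u_1<a+p_1-p_2$. Prices are not observed before search, so search decisions depend on the actual $p_1$ and the expected (equilibrium) $p_2$. Given a candidate pair $(p_1,p_2)$, the deviation profits are as follows. If Firm 1 charges $p$ instead of $p_1$, $$\pi_1(p)=(p+r-r_s)\Big[1-(a+p-p_2)+\tfrac12a^2-\tfrac12(p_2-r_s)^2\Big]-(r-r_s).$$ If Firm 2 charges $p$ instead of $p_2$, $$\pi_2(p)=(p+r-r_s)\Big[(a+p_1-p_2)(1-a+p_2-p)+\tfrac12(a+2p_1-r_s-p_2)(a-p_2+r_s)\Big]-(r-r_s)(a+p_1-p_2).$$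 A pair $(p_1,p_2)$ of nonnegative prices is an equilibrium if $p_1$ maximizes $\pi_1(\cdot)$ over $p\ge0$ and $p_2$ maximizes $\pi_2(\cdot)$ over $p\ge0$; $\pi_1,\pi_2$ denote the equilibrium profits $\pi_1(p_1),\pi_2(p_2)$. At $r_s=0$ and $r\in[0,1]$ the paper shows there is exactly one equilibrium with $p_1,p_2\in[0,\frac{1-r}2]$; this is the equilibrium at $r_s=0$. In $\bar r(a)$ the value $a=1-\sqrt{2s}$ (i.e. $r_s=0$) is used. The platform's advertising fee (maximal revenue from the position auction for prominence) is $\pi_1-\pi_2$. *)

theory Defs
  imports "HOL-Analysis.Analysis"
begin

text \<open>
  Throughout, \<open>s\<close> is the search cost, \<open>r\<close> the total return cost and \<open>rs\<close> the part of \<open>r\<close>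
  borne by the consumer. The consumer's return cost adds to the search cost, so the
  reservation value is computed from \<open>s + rs\<close>.
\<close>

definition reservation :: "real \<Rightarrow> real \<Rightarrow> real" where
  "reservation s rs = 1 - sqrt (2 * (s + rs))"

definition rbar :: "real \<Rightarrow> real" where
  "rbar a = (1 - 2 * a + sqrt (4 * a\<^sup>2 - 4 * a + 9)) / 4"

text \<open>
  In the two profit functions the last argument \<open>p\<close> is the price actually charged by the firm,
  while \<open>p1\<close>, \<open>p2\<close> are the candidate equilibrium prices. Firm 1's profit does not involve its
  own candidate price, because consumers observe its actual price before they search.
  Firm 2's price is only expected before search, so its profit involves both \<open>p2\<close> and \<open>p\<close>.
\<close>

definition profit1 :: "real \<Rightarrow> real \<Rightarrow> real \<Rightarrow> real \<Rightarrow> real \<Rightarrow> real" where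
  "profit1 s r rs p2 p =
     (let a = reservation s rs in
       (p + r - rs) * (1 - (a + p - p2) + a\<^sup>2 / 2 - (p2 - rs)\<^sup>2 / 2) - (r - rs))"

definition profit2 :: "real \<Rightarrow> real \<Rightarrow> real \<Rightarrow> real \<Rightarrow> real \<Rightarrow> real \<Rightarrow> real" where
  "profit2 s r rs p1 p2 p =
     (let a = reservation s rs in
       (p + r - rs) * ((a + p1 - p2) * (1 - a + p2 - p)
                        + (a + 2 * p1 - rs - p2) * (a - p2 + rs) / 2)
       - (r - rs) * (a + p1 - p2))"

definition is_equilibrium :: "real \<Rightarrow> real \<Rightarrow> real \<Rightarrow> real \<times> real \<Rightarrow> bool" where
  "is_equilibrium s r rs = (\<lambda>(p1, p2).
     0 \<le> p1 \<and> 0 \<le> p2 \<and>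
     (\<forall>p\<ge>0. profit1 s r rs p2 p \<le> profit1 s r rs p2 p1) \<and>
     (\<forall>p\<ge>0. profit2 s r rs p1 p2 p \<le> profit2 s r rs p1 p2 p2))"

definition ad_fee :: "real \<Rightarrow> real \<Rightarrow> real \<Rightarrow> real \<times> real \<Rightarrow> real" where
  "ad_fee s r rs = (\<lambda>(p1, p2). profit1 s r rs p2 p1 - profit2 s r rs p1 p2 p2)"

text \<open>
  For \<open>r \<in> {0..1}\<close> there is exactly one equilibrium at \<open>rs = 0\<close> with both prices in
  \<open>{0..(1 - r) / 2}\<close>; the box condition on \<open>q 0\<close> therefore selects that equilibrium as the
  starting point of the branch.
\<close>

definition equilibrium_branch :: "real \<Rightarrow> real \<Rightarrow> real \<Rightarrow> (real \<Rightarrow> real \<times> real) \<Rightarrow> bool" where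
  "equilibrium_branch s r \<delta> q \<longleftrightarrow>
     continuous_on {0..\<delta>} q \<and>
     q 0 \<in> {0..(1 - r) / 2} \<times> {0..(1 - r) / 2} \<and>
     (\<forall>rs\<in>{0..\<delta>}. is_equilibrium s r rs (q rs))"

end

theory Submission
  imports Defs
begin

text \<open>
  Write \<open>x\<^sub>i = p\<^sub>i - rs\<close>, \<open>w = a - x\<^sub>2\<close>, let \<open>m = a + x\<^sub>1 - x\<^sub>2\<close> be the probability that
  product 2 is bought, and \<open>e = 1 - r - 2 x\<^sub>2\<close>. The first-order condition of Firm 2 becomes
  \<open>2 m e = w\<^sup>2\<close>, and that of Firm 1 becomes
  \<open>2 m = max (2 (w - rs)) (1 - r + (1 + a) w - w\<^sup>2 / 2)\<close>, where the first argument is the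
  corner \<open>p\<^sub>1 = 0\<close>; the return costs enter only through \<open>r\<close>, \<open>a\<close> and that corner.
  Substituting the second condition into the first gives one equation in \<open>w\<close> that is strictly
  increasing on the relevant range, hence a continuous branch.

  On any branch, \<open>0\<close> is a limit point of the set of \<open>rs\<close> at which \<open>p\<^sub>1\<close> is interior or of the
  set at which \<open>p\<^sub>1 = 0\<close>. Relative to such a set the fee is differentiable at \<open>0\<close>, and for \<open>a\<close>
  close to \<open>1/2\<close> (that is, \<open>s\<close> close to \<open>1/8\<close>) both derivatives are positive. The bound
  on \<open>r\<close> gives \<open>r < 1 - a / 2\<close>, which excludes \<open>p\<^sub>2 = 0\<close>.
\<close>

section \<open>Best responses and the fee at an equilibrium\<close>

text \<open>Completing the square at \<open>v = (K - c) / 2\<close> turns maximization into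
  minimizing the distance to \<open>v\<close> over the half-line.\<close>

lemma quadratic_max_iff:
  fixes x c K :: real
  assumes "0 \<le> x"
  shows "(\<forall>p\<ge>0. (p + c) * (K - p) \<le> (x + c) * (K - x)) \<longleftrightarrow> x = max 0 ((K - c) / 2)"
proof -
  define v where "v = (K - c) / 2"
  have *: "(p + c) * (K - p) \<le> (x + c) * (K - x) \<longleftrightarrow> (x - v)\<^sup>2 \<le> (p - v)\<^sup>2" for p
  proof -
    have "(x + c) * (K - x) - (p + c) * (K - p) = (p - v)\<^sup>2 - (x - v)\<^sup>2"
      unfolding v_def power2_eq_square by (simp add: field_simps)
    then show ?thesis by linarith
  qed
  have "(\<forall>p\<ge>0. (x - v)\<^sup>2 \<le> (p - v)\<^sup>2) \<longleftrightarrow> x = max 0 v"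
  proof
    assume le: "\<forall>p\<ge>0. (x - v)\<^sup>2 \<le> (p - v)\<^sup>2"
    show "x = max 0 v"
    proof (cases "v \<ge> 0")
      case True
      then have "(x - v)\<^sup>2 \<le> 0" using le[rule_format, of v] by simp
      then show ?thesis using True by simp
    next
      case False
      then have "\<bar>x - v\<bar> \<le> \<bar>0 - v\<bar>" using le[rule_format, of 0] abs_le_square_iff by blast
      then show ?thesis using False assms by auto
    qed
  next
    assume x: "x = max 0 v"
    show "\<forall>p\<ge>0. (x - v)\<^sup>2 \<le> (p - v)\<^sup>2"
      using x by (auto simp: max_def abs_le_square_iff[symmetric] split: if_splits)
  qed
  then show ?thesis by (simp add: * v_def[symmetric])
qed

text \<open>Up to an additive constant and, for Firm 2, the positive factor \<open>m\<close>, each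
  deviation profit has the form \<open>(p + c) * (K - p)\<close>, with \<open>L\<close> in place of
  \<open>K\<close> for Firm 2. So each best response is a maximum with 0.\<close>

lemma equilibrium_iff:
  fixes s r rs p1 p2 :: real
  defines "a \<equiv> reservation s rs"
  defines "w \<equiv> a - p2 + rs" and "m \<equiv> a + p1 - p2"
  assumes p: "0 \<le> p1" "0 \<le> p2" and m: "0 < m"
  shows "is_equilibrium s r rs (p1, p2) \<longleftrightarrow>
      2 * m = max (2 * (w - rs)) (1 - r + (1 + a) * w - w\<^sup>2 / 2) \<and>
      2 * m * (1 - r - 2 * a + 2 * w) \<le> w\<^sup>2 \<and>
      (p2 = 0 \<or> 2 * m * (1 - r - 2 * a + 2 * w) = w\<^sup>2)"
proof -
  define c where "c = r - rs"
  define K where "K = 1 - a + p2 + a\<^sup>2 / 2 - (p2 - rs)\<^sup>2 / 2"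
  define L where "L = 1 - a + p2 + (a + 2 * p1 - rs - p2) * (a - p2 + rs) / 2 / m"
  define G where "G = 2 * m * (1 - r - 2 * a + 2 * w) - w\<^sup>2"
  have 1: "profit1 s r rs p2 p = (p + c) * (K - p) - c" for p
    by (simp add: profit1_def Let_def a_def[symmetric] c_def K_def algebra_simps)
  have "m * (1 - a + p2 - p) + (a + 2 * p1 - rs - p2) * (a - p2 + rs) / 2 = m * (L - p)" for p
    using m by (simp add: L_def field_simps)
  moreover have "profit2 s r rs p1 p2 p =
      (p + c) * (m * (1 - a + p2 - p) + (a + 2 * p1 - rs - p2) * (a - p2 + rs) / 2) - c * m" for p
    by (simp add: profit2_def Let_def a_def[symmetric] c_def m_def)
  ultimately have 2: "profit2 s r rs p1 p2 p = m * ((p + c) * (L - p)) - c * m" for p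
    by simp
  have e1: "p1 = max 0 ((K - c) / 2) \<longleftrightarrow> 2 * m = max (2 * (w - rs)) (1 - r + (1 + a) * w - w\<^sup>2 / 2)"
  proof -
    have "(K - c) / 2 = (1 - r + (1 + a) * w - w\<^sup>2 / 2) / 2 - w + rs"
      by (simp add: K_def c_def w_def power2_eq_square field_simps)
    then show ?thesis unfolding max_def m_def w_def by (auto simp: field_simps)
  qed
  have L: "(L - c) / 2 = p2 + G / (4 * m)"
  proof -
    have "m * (L - c - 2 * p2) = G / 2"
      using m unfolding L_def G_def c_def w_def
      by (simp add: m_def power2_eq_square field_simps)
    then show ?thesis using m by (simp add: field_simps)
  qed
  have e2: "p2 = max 0 ((L - c) / 2) \<longleftrightarrow> G \<le> 0 \<and> (p2 = 0 \<or> G = 0)"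
  proof -
    have "G / (4 * m) \<le> 0 \<longleftrightarrow> G \<le> 0" "G / (4 * m) = 0 \<longleftrightarrow> G = 0"
      using m by (simp_all add: divide_le_0_iff)
    then show ?thesis unfolding L max_def using p by auto
  qed
  have "is_equilibrium s r rs (p1, p2) \<longleftrightarrow> p1 = max 0 ((K - c) / 2) \<and> p2 = max 0 ((L - c) / 2)"
    using p m by (simp add: is_equilibrium_def 1 2 quadratic_max_iff)
  then show ?thesis unfolding e1 e2 G_def by auto
qed

text \<open>The first-order condition of Firm 2 makes its demand \<open>m\<close> times its unit
  margin \<open>a - w + r = p2 + r - rs\<close>, hence the square in the last term. Likewise
  \<open>m - w + r\<close> is the unit margin of Firm 1.\<close>

lemma ad_fee_equilibrium:
  fixes s r rs p1 p2 :: real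
  defines "a \<equiv> reservation s rs"
  defines "w \<equiv> a - p2 + rs" and "m \<equiv> a + p1 - p2"
  assumes foc2: "2 * m * (1 - r - 2 * a + 2 * w) = w\<^sup>2"
  shows "ad_fee s r rs (p1, p2) =
    (m - w + r) * (1 - m + a * w - w\<^sup>2 / 2) - (r - rs) * (1 - m) - (a - w + r)\<^sup>2 * m"
proof -
  have "m * (1 - a) + (a + 2 * p1 - rs - p2) * (a - p2 + rs) / 2 = (a - w + r) * m"
    using foc2 unfolding w_def m_def by (simp add: power2_eq_square field_simps)
  then have "profit2 s r rs p1 p2 p2 = (p2 + r - rs) * ((a - w + r) * m) - (r - rs) * m"
    by (simp add: profit2_def Let_def a_def[symmetric] m_def)
  then show ?thesis
    unfolding ad_fee_def
    by (simp add: profit1_def Let_def a_def[symmetric] m_def w_def power2_eq_square field_simps)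
qed

section \<open>Continuity and derivatives of implicitly defined functions\<close>

text \<open>The graph of \<open>g\<close> is the zero set of \<open>F\<close>, hence closed, and a
  map into a compact set with closed graph is continuous.\<close>

lemma root_continuous:
  fixes F :: "real \<Rightarrow> real \<Rightarrow> real" and g :: "real \<Rightarrow> real"
  assumes "compact W"
    and cont: "continuous_on (T \<times> W) (\<lambda>(t, x). F t x)"
    and g: "\<And>t. t \<in> T \<Longrightarrow> g t \<in> W"
    and root: "\<And>t x. t \<in> T \<Longrightarrow> x \<in> W \<Longrightarrow> F t x = 0 \<longleftrightarrow> x = g t"
  shows "continuous_on T g"
proof -
  have "(\<lambda>t. (t, g t)) ` T = (T \<times> W) \<inter> (\<lambda>(t, x). F t x) -` {0}"
    using g root by auto
  moreover have "closedin (top_of_set (T \<times> W)) ((T \<times> W) \<inter> (\<lambda>(t, x). F t x) -` {0})"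
    using cont by (intro continuous_closedin_preimage) auto
  ultimately have "closedin (top_of_set (T \<times> W)) ((\<lambda>t. (t, g t)) ` T)" by simp
  then show ?thesis
    using continuous_closed_graph_eq[OF \<open>compact W\<close>, of g T] g by auto
qed

text \<open>\<open>P0\<close>, \<open>P\<close> and \<open>Q\<close> are divided differences of an
  implicit equation in the parameter, in \<open>u\<close> and in \<open>v\<close>. Dividing by
  \<open>t - x\<close> yields differentiability of \<open>v\<close> as a conclusion. The set
  \<open>S\<close> will be the set of parameters at which one regime of Firm 1 holds.\<close>

lemma implicit_derivative:
  fixes u v P0 P Q :: "real \<Rightarrow> real"
  assumes u: "(u has_real_derivative u') (at x within S)"
    and P0: "(P0 \<longlongrightarrow> A0) (at x within S)" and P: "(P \<longlongrightarrow> A) (at x within S)"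
    and Q: "(Q \<longlongrightarrow> B) (at x within S)" and "B \<noteq> 0"
    and eq: "\<And>t. t \<in> S \<Longrightarrow> (t - x) * P0 t + (u t - u x) * P t + (v t - v x) * Q t = 0"
  shows "(v has_real_derivative - (A0 + u' * A) / B) (at x within S)"
proof -
  have lim: "((\<lambda>t. - (P0 t + (u t - u x) / (t - x) * P t) / Q t) \<longlongrightarrow> - (A0 + u' * A) / B) (at x within S)"
    using u P0 P Q \<open>B \<noteq> 0\<close> unfolding has_field_derivative_iff by (intro tendsto_intros)
  have "\<forall>\<^sub>F t in at x within S. Q t \<noteq> 0"
    using Q \<open>B \<noteq> 0\<close> by (rule tendsto_imp_eventually_ne)
  moreover have "\<forall>\<^sub>F t in at x within S. t \<in> S \<and> t \<noteq> x"
    by (simp add: eventually_at_filter)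
  ultimately have "\<forall>\<^sub>F t in at x within S.
      - (P0 t + (u t - u x) / (t - x) * P t) / Q t = (v t - v x) / (t - x)"
  proof eventually_elim
    case (elim t)
    define h du where "h = t - x" and "du = u t - u x"
    have "(v t - v x) * Q t = - (h * P0 t + du * P t)"
      using eq[of t] elim by (simp add: h_def du_def)
    then have v: "v t - v x = - (h * P0 t + du * P t) / Q t"
      using elim by (simp add: eq_divide_eq)
    have "h \<noteq> 0" using elim by (simp add: h_def)
    then have "- (P0 t + du / h * P t) / Q t = - (h * P0 t + du * P t) / Q t / h"
      by (simp add: divide_simps)
    then show ?case unfolding v by (simp add: h_def du_def)
  qed
  with lim show ?thesis
    unfolding has_field_derivative_iff by (rule Lim_transform_eventually)
qed

section \<open>Positivity of the derivative of the fee for \<open>a\<close> near 1/2\<close>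

text \<open>The derivative of the fee at \<open>rs = 0\<close> when \<open>a\<close>, \<open>w\<close>, \<open>m\<close> have derivatives \<open>a'\<close>, \<open>w'\<close>, \<open>m'\<close>.\<close>

definition fee_slope :: "real \<Rightarrow> real \<Rightarrow> real \<Rightarrow> real \<Rightarrow> real \<Rightarrow> real \<Rightarrow> real \<Rightarrow> real" where
  "fee_slope r a w m a' w' m' =
     (m' - w') * (1 - m + a * w - w\<^sup>2 / 2) + (m - w + r) * (- m' + a' * w + a * w' - w * w')
     + (1 - m) + r * m' - 2 * (a - w + r) * (a' - w') * m - (a - w + r)\<^sup>2 * m'"

text \<open>At the corner \<open>m = w - rs\<close>, so \<open>m' = w' - 1\<close>, and linearizing
  \<open>2 * (w - rs) * e = w\<^sup>2\<close> gives \<open>w' = (1 + 4 * a') / 3\<close>.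
  Eliminating \<open>r\<close> and bounding term by term leaves a positive quadratic in
  \<open>w\<close>.\<close>

lemma fee_slope_corner_pos:
  fixes a r w a' :: real
  assumes a: "1/2 \<le> a" "a \<le> 501/1000" and w: "0 < w" "w \<le> a"
    and foc2: "2 * w * (1 - r - 2 * a + 2 * w) = w\<^sup>2"
    and a': "a' = - 1 / (1 - a)"
  shows "0 < fee_slope r a w w a' ((1 + 4 * a') / 3) ((1 + 4 * a') / 3 - 1)"
proof -
  have r: "r = 1 - 2 * a + 3 * w / 2"
    using foc2 w by (simp add: power2_eq_square)
  define b where "b = - a'"
  have b: "2 \<le> b" "b \<le> 201/100" and ab: "a * b = b - 1"
    using a by (auto simp: b_def a' field_simps)
  define g where "g = a - w + r"
  have g: "g = 1 - a + w / 2" by (simp add: g_def r)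
  have "fee_slope r a w w a' ((1 + 4 * a') / 3) ((1 + 4 * a') / 3 - 1) =
      g\<^sup>2 * ((4 * b + 2) / 3) - w * (2 * a - w) / 2 - r * (b * w + (a - w) * ((4 * b - 1) / 3))
      - 2 / 3 * g * (b - 1) * w"
    unfolding fee_slope_def g_def[symmetric] b_def power2_eq_square by (simp add: field_simps)
  also have "b * w + (a - w) * ((4 * b - 1) / 3) = (b - 1) * (1 + (a - w) / 3)"
    using ab by (simp add: field_simps)
  finally have eq: "fee_slope r a w w a' ((1 + 4 * a') / 3) ((1 + 4 * a') / 3 - 1) =
      g\<^sup>2 * ((4 * b + 2) / 3) - w * (2 * a - w) / 2 - r * ((b - 1) * (1 + (a - w) / 3))
      - 2 / 3 * g * (b - 1) * w" .
  have 1: "(499/1000 + w / 2)\<^sup>2 * (10 / 3) \<le> g\<^sup>2 * ((4 * b + 2) / 3)"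
    using a w b by (intro mult_mono power_mono) (auto simp: g)
  have 2: "w * (2 * a - w) / 2 \<le> w * (1002/1000 - w) / 2"
    using a w by (intro divide_right_mono mult_left_mono) auto
  have 3: "r * ((b - 1) * (1 + (a - w) / 3)) \<le> (3 * w / 2) * (101/100 * (1 + (501/1000 - w) / 3))"
    using a w b r by (intro mult_mono) auto
  have 4: "2 / 3 * g * (b - 1) * w \<le> 2 / 3 * (1/2 + w / 2) * (101/100) * w"
    using a w b by (intro mult_mono) (auto simp: g)
  \<comment> \<open>The number 3/10 is close to the minimizer of the quadratic below.\<close>
  have "0 \<le> (w - 3/10)\<^sup>2" by simp
  then have "0 < (499/1000 + w / 2)\<^sup>2 * (10 / 3) - w * (1002/1000 - w) / 2
      - (3 * w / 2) * (101/100 * (1 + (501/1000 - w) / 3)) - 2 / 3 * (1/2 + w / 2) * (101/100) * w"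
    using a w by (simp add: power2_eq_square field_simps)
  also have "\<dots> \<le> fee_slope r a w w a' ((1 + 4 * a') / 3) ((1 + 4 * a') / 3 - 1)"
    unfolding eq by (intro diff_mono 1 2 3 4)
  finally show ?thesis .
qed

text \<open>The hypothesis on \<open>w'\<close> and the last argument of \<open>fee_slope\<close>
  are the linearized first-order conditions. The conditions themselves confine \<open>w\<close>,
  \<open>m\<close> and \<open>e\<close> so tightly that \<open>D\<close>, \<open>E\<close> and
  \<open>br\<close> have polynomial lower bounds in \<open>w\<close>, which reduces the claim to a
  cubic inequality.\<close>

lemma fee_slope_interior_pos:
  fixes a r w m e a' w' :: real
  assumes a: "1/2 \<le> a" "a \<le> 501/1000" and w: "0 < w" "w \<le> m"
    and foc1: "2 * m = 1 - r + (1 + a) * w - w\<^sup>2 / 2"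
    and e: "e = 1 - r - 2 * a + 2 * w"
    and foc2: "2 * m * e = w\<^sup>2"
    and a': "a' = - 1 / (1 - a)"
    and w': "w' * (e * (1 + a - w) + 4 * m - 2 * w) = a' * (4 * m - e * w)"
  shows "0 < fee_slope r a w m a' w' (((1 + a - w) * w' + w * a') / 2)"
proof -
  \<comment> \<open>\<open>y = - N / D\<close> is the derivative of \<open>x\<^sub>2\<close> along the branch with respect to \<open>a\<close>, and the slope
    times \<open>(1 - a) D\<close> equals \<open>D E + N br\<close>.\<close>
  define D N where "D = (e * (1 + a - w) + 4 * m - 2 * w) / 2"
    and "N = w - e * (1 + a) / 2"
  define g C0 where "g = 1 - a + w - e" and "C0 = r - g\<^sup>2"
  define E br where "E = (1 - a) * (1 - w + r) - (1 + a) / 2 * C0"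
    and "br = (1 - a + w) * (w - m - e) + w\<^sup>2 - (1 - a + w) * (2 * a - 1) - (1 + a - w) / 2 * C0"
  have r: "r = 1 - 2 * a + 2 * w - e" using e by simp
  have e_pos: "0 < e"
  proof -
    have "0 < 2 * m * e" using foc2 w by simp
    then show ?thesis using w by (simp add: zero_less_mult_iff)
  qed
  then have "2 * w * e \<le> 2 * m * e" using w by (intro mult_right_mono) auto
  then have e_le: "e \<le> w / 2" using foc2 w by (simp add: power2_eq_square)
  have m_eq: "2 * m = 2 * a - (1 - a) * w - w\<^sup>2 / 2 + e"
    using foc1 r by (simp add: algebra_simps)
  \<comment> \<open>Together with \<open>e \<le> w / 2\<close>, the bound
    \<open>2 * w \<le> 2 * m\<close> gives \<open>1.999 * w + w\<^sup>2 / 2 \<le> 1.002\<close>,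
    whose positive root is just below 451/1000.\<close>
  have w1: "w \<le> 451/1000"
  proof (rule ccontr)
    assume "\<not> ?thesis"
    then have c: "451/1000 < w" by simp
    then have "451/1000 * (451/1000) < w * w" by (intro mult_strict_mono) auto
    moreover have "a * w \<le> 501/1000 * w" using a w by (intro mult_right_mono) auto
    moreover have "2 * m = 2 * a - w + a * w - w * w / 2 + e"
      using m_eq by (simp add: power2_eq_square algebra_simps)
    ultimately show False using e_le w a c by linarith
  qed
  have aw: "(a - 1/2) * w \<le> 1/1000 * (451/1000)" "0 \<le> (a - 1/2) * w"
    using a w w1 by (intro mult_mono mult_nonneg_nonneg; simp)+
  have m1: "2 * m \<le> 1003/1000"
  proof -
    have "2 * m = 2 * a - w / 2 + (a - 1/2) * w - w\<^sup>2 / 2 + e"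
      using m_eq by (simp add: algebra_simps)
    then show ?thesis using e_le aw a zero_le_power2[of w] by linarith
  qed
  have e_ge: "99/100 * w\<^sup>2 \<le> e"
  proof -
    have "w\<^sup>2 \<le> 1003/1000 * e" unfolding foc2[symmetric] using m1 e_pos by (intro mult_right_mono) auto
    then show ?thesis using e_pos by simp
  qed
  have m2: "1 - w / 2 + 49/100 * w\<^sup>2 \<le> 2 * m"
    using m_eq aw a e_ge by (simp add: algebra_simps)
  have D: "1 - 3/2 * w + 49/100 * w\<^sup>2 \<le> D"
  proof -
    have "0 \<le> e * (1 + a - w)" using e_pos a w1 by simp
    then show ?thesis using m2 by (simp add: D_def)
  qed
  have r1: "3/2 * w - 2/1000 \<le> r" using r a e_le by simp
  have C0: "C0 \<le> 1/4"
  proof -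
    have "0 \<le> (g - 1/2)\<^sup>2" by simp
    then have "g - 1/4 \<le> g\<^sup>2" by (simp add: power2_eq_square algebra_simps)
    moreover have "r \<le> g" using r w1 a by (simp add: g_def)
    ultimately show ?thesis by (simp add: C0_def)
  qed
  have E: "31/100 + 249/1000 * w \<le> E"
  proof -
    have "499/1000 * (998/1000 + w / 2) \<le> (1 - a) * (1 - w + r)"
      using a r1 w by (intro mult_mono) auto
    moreover have "(1 + a) / 2 * C0 \<le> (1 + a) / 2 * (1/4)"
      using C0 a by (intro mult_left_mono) auto
    moreover have "31/100 + 249/1000 * w \<le> 499/1000 * (998/1000 + w / 2) - (1 + a) / 2 * (1/4)"
      using a w by (simp add: field_simps)
    ultimately show ?thesis unfolding E_def by (meson diff_mono order_trans)
  qed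
  have br: "- 48/100 + 3/10 * w \<le> br"
  proof -
    have 1: "w - m - e \<ge> - 501/1000 + 499/1000 * w + w\<^sup>2 / 4"
    proof -
      have "a * w \<le> 501/1000 * w" using a w by (intro mult_right_mono) auto
      moreover have "2 * m = 2 * a - w + a * w - w\<^sup>2 / 2 + e"
        using m_eq by (simp add: algebra_simps)
      ultimately show ?thesis using e_le a w by linarith
    qed
    have 2: "(1 - a + w) * (w - m - e) \<ge> (1 - a + w) * (- 501/1000 + 499/1000 * w + w\<^sup>2 / 4)"
      using 1 a w by (intro mult_left_mono) auto
    have neg: "- 501/1000 + 499/1000 * w + w\<^sup>2 / 4 \<le> 0"
    proof -
      have "w\<^sup>2 \<le> (451/1000)\<^sup>2" using w w1 by (intro power_mono) auto
      then show ?thesis using w1 by (simp add: power2_eq_square)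
    qed
    \<comment> \<open>The second factor is nonpositive, so raising \<open>1 - a\<close> to 1/2
      lowers the product.\<close>
    have 3: "(1 - a + w) * (- 501/1000 + 499/1000 * w + w\<^sup>2 / 4)
        \<ge> (1/2 + w) * (- 501/1000 + 499/1000 * w + w\<^sup>2 / 4)"
      using neg a by (intro mult_right_mono_neg) auto
    have 4: "(1 - a + w) * (2 * a - 1) \<le> 951/1000 * (2/1000)"
      using a w w1 by (intro mult_mono) auto
    have 5: "(1 + a - w) / 2 * C0 \<le> (1 + a - w) / 2 * (1/4)"
      using C0 a w1 by (intro mult_left_mono) auto
    have 6: "0 \<le> w ^ 3" using w by simp
    \<comment> \<open>The number 13/100 is close to the minimizer of the quadratic part of the
      remaining difference.\<close>
    have 7: "0 \<le> (w - 13/100)\<^sup>2" by simp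
    have "br \<ge> (1/2 + w) * (- 501/1000 + 499/1000 * w + w\<^sup>2 / 4) + w\<^sup>2 - 951/1000 * (2/1000) - (1 + a - w) / 8"
      unfolding br_def using 2 3 4 5 by linarith
    then show ?thesis using a w1 6 7 by (simp add: power2_eq_square power3_eq_cube field_simps)
  qed
  have N: "0 \<le> N" "N \<le> w"
  proof -
    have "e * (1 + a) \<le> (w / 2) * 2" using e_le e_pos a w by (intro mult_mono) auto
    then show "0 \<le> N" using w by (simp add: N_def)
    show "N \<le> w" using e_pos a by (simp add: N_def)
  qed
  have D_low: "0 < 1 - 3/2 * w + 49/100 * w\<^sup>2" using w1 zero_le_power2[of w] by linarith
  have main: "0 < D * E + N * br"
  proof -
    have "(1 - 3/2 * w + 49/100 * w\<^sup>2) * (31/100 + 249/1000 * w) \<le> D * E"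
      using D E D_low w by (intro mult_mono) auto
    moreover have "N * br \<ge> N * (- 48/100 + 3/10 * w)" using br N by (intro mult_left_mono) auto
    \<comment> \<open>The bound on \<open>br\<close> is negative here, so the largest
      \<open>N\<close> is the worst case.\<close>
    moreover have "N * (- 48/100 + 3/10 * w) \<ge> w * (- 48/100 + 3/10 * w)"
      using N w1 by (intro mult_right_mono_neg) auto
    moreover have "0 < (1 - 3/2 * w + 49/100 * w\<^sup>2) * (31/100 + 249/1000 * w) + w * (- 48/100 + 3/10 * w)"
    proof -
      have "(1 - 3/2 * w + 49/100 * w\<^sup>2) * (31/100 + 249/1000 * w) + w * (- 48/100 + 3/10 * w)
          = 31/100 - 696/1000 * w + 784/10000 * w\<^sup>2 + 12201/100000 * w ^ 3"
        by (simp add: power2_eq_square power3_eq_cube field_simps)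
      \<comment> \<open>The cubic decreases in \<open>w\<close> on this range, so
        \<open>w\<^sup>2\<close> is replaced by its tangent near the right endpoint.\<close>
      moreover have "0 \<le> (w - 45/100)\<^sup>2" by simp
      then have "w\<^sup>2 \<ge> 9/10 * w - 2025/10000" by (simp add: power2_eq_square field_simps)
      moreover have "0 \<le> w ^ 3" using w by simp
      ultimately show ?thesis using w1 by linarith
    qed
    ultimately show ?thesis by linarith
  qed
  have D_pos: "0 < D" using D D_low by linarith
  define y where "y = - N / D"
  have yD: "y * D = - N" using D_pos by (simp add: y_def)
  have w'_eq: "w' = a' * (1 - y)"
  proof -
    have D2: "2 * D = e * (1 + a - w) + 4 * m - 2 * w" by (simp add: D_def)
    then have "2 * D + 2 * N = 4 * m - e * w" by (simp add: N_def field_simps)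
    then have "w' * (2 * D) = a' * (2 * D - 2 * (y * D))"
      unfolding yD using w' by (simp add: D2)
    also have "\<dots> = a' * (1 - y) * (2 * D)" by (simp add: algebra_simps)
    finally show ?thesis using D_pos by simp
  qed
  have a'1: "(1 - a) * a' = - 1" using a by (simp add: a')
  define m' where "m' = ((1 + a - w) * w' + w * a') / 2"
  define Q where "Q = 2 * (m - w + r) * (((1 - a + w) * y - (1 - a)) / 2) - 2 * g * m * y
      + (r - g\<^sup>2) * (1 + ((1 - a + w) * y - (1 - a)) / 2 - y)"
  have ga: "a - w + r = g" using r by (simp add: g_def)
  \<comment> \<open>For an interior price, the demand of Firm 1 equals its unit margin.\<close>
  have k: "1 - m + a * w - w\<^sup>2 / 2 = m - w + r" using foc1 by (simp add: algebra_simps)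
  have m'_eq: "m' - w' = a' * (((1 - a + w) * y - (1 - a)) / 2)"
    unfolding m'_def w'_eq by (simp add: algebra_simps add_divide_distrib diff_divide_distrib)
  \<comment> \<open>The term \<open>1 - m\<close> is the direct effect of \<open>rs\<close>. All
    else is proportional to \<open>a'\<close>, since in this regime \<open>w\<close> and
    \<open>m\<close> depend on \<open>rs\<close> through \<open>a\<close> only.\<close>
  have slope: "fee_slope r a w m a' w' m' = (1 - m) + a' * Q"
  proof -
    have h: "- m' + a' * w + a * w' - w * w' = m' - w'"
      by (simp add: m'_def field_simps)
    have "fee_slope r a w m a' w' m' = 2 * (m - w + r) * (m' - w') + (1 - m) + r * m'
        - 2 * g * (a' - w') * m - g\<^sup>2 * m'"
      unfolding fee_slope_def k ga h by (simp add: algebra_simps)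
    also have "\<dots> = 2 * (m - w + r) * (m' - w') + (1 - m) + (r - g\<^sup>2) * ((m' - w') + w')
        - 2 * g * (a' - w') * m"
      by (simp add: algebra_simps)
    finally show ?thesis
      unfolding m'_eq unfolding w'_eq Q_def by (simp add: algebra_simps)
  qed
  have "(1 - a) * fee_slope r a w m a' w' m' = (1 - a) * (1 - m) - Q"
  proof -
    have "(1 - a) * (a' * Q) = - Q" using a'1 by (simp add: mult.assoc[symmetric])
    then show ?thesis unfolding slope by (simp add: distrib_left)
  qed
  also have "\<dots> = E - y * br"
  proof -
    have "Q = - (1 - a) / 2 * (2 * (m - w + r) + C0) + C0
        + y * ((1 - a + w) * (m - w + r) - 2 * g * m - (1 + a - w) / 2 * C0)"
      unfolding Q_def C0_def[symmetric] by (simp add: field_simps)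
    moreover have "(1 - a + w) * (m - w + r) - 2 * g * m - (1 + a - w) / 2 * C0 = br"
      unfolding br_def foc2[symmetric] g_def r by (simp add: algebra_simps)
    ultimately have "Q = - (1 - a) / 2 * (2 * (m - w + r) + C0) + C0 + y * br"
      by (simp only:)
    then show ?thesis by (simp add: E_def field_simps)
  qed
  finally have "(1 - a) * fee_slope r a w m a' w' m' = E - y * br" .
  then have "D * ((1 - a) * fee_slope r a w m a' w' m') = D * (E - y * br)"
    by simp
  also have "\<dots> = D * E - (y * D) * br"
    by (simp add: algebra_simps)
  finally have "D * ((1 - a) * fee_slope r a w m a' w' m') = D * E + N * br"
    by (simp add: yD)
  then have "0 < D * ((1 - a) * fee_slope r a w m a' w' m')" using main by simp
  then show ?thesis using D_pos a by (simp add: zero_less_mult_iff m'_def)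
qed

section \<open>The reservation value and \<open>rbar\<close>\<close>

lemma reservation_bounds:
  assumes s: "(499/1000)\<^sup>2 / 2 \<le> s" and rs: "0 \<le> rs" "s + rs < 1/8"
  shows "1/2 < reservation s rs" "reservation s rs \<le> 501/1000"
proof -
  have "sqrt (2 * (s + rs)) < 1/2"
    using rs by (intro real_less_lsqrt) (auto simp: power2_eq_square)
  moreover have "499/1000 \<le> sqrt (2 * (s + rs))"
    using s rs by (intro real_le_rsqrt) auto
  ultimately show "1/2 < reservation s rs" "reservation s rs \<le> 501/1000"
    by (auto simp: reservation_def)
qed

lemma reservation_antimono: "rs \<le> rs' \<Longrightarrow> reservation s rs' \<le> reservation s rs"
  by (simp add: reservation_def)

lemma continuous_on_reservation [continuous_intros]: "continuous_on T (reservation s)"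
  unfolding reservation_def by (intro continuous_intros)

lemma reservation_has_derivative:
  assumes "0 < s"
  shows "(reservation s has_real_derivative - 1 / (1 - reservation s 0)) (at 0 within T)"
proof -
  have "((\<lambda>rs. 1 - sqrt (2 * (s + rs))) has_real_derivative - (2 * inverse (sqrt (2 * s)) / 2)) (at 0 within T)"
    using assms by (auto intro!: derivative_eq_intros)
  then show ?thesis
    by (simp add: reservation_def[abs_def] field_simps)
qed

text \<open>The radicand is \<open>9 - 4 * a * (1 - a) < 9\<close>. The resulting bound on
  \<open>r\<close> says \<open>a < 2 * (1 - r)\<close>, the form used against the corner
  \<open>p2 = 0\<close>.\<close>

lemma rbar_less:
  assumes "0 < a" "a < 1"
  shows "rbar a < 1 - a / 2"
proof -
  have "a * a < a" using assms by simp
  then have "sqrt (4 * a\<^sup>2 - 4 * a + 9) < sqrt (3\<^sup>2)"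
    by (intro real_sqrt_less_mono) (simp add: power2_eq_square)
  then have "sqrt (4 * a\<^sup>2 - 4 * a + 9) < 3" by simp
  then show ?thesis by (simp add: rbar_def field_simps)
qed

section \<open>Existence of a continuous equilibrium branch\<close>

text \<open>The increment is \<open>e w * (n w' - n w) + (w' - w) * (2 * n w' - w - w')\<close>. The
  first term is nonnegative; the second is positive because \<open>n w' \<ge> 2 * (w' - rs)\<close>,
  which covers both regimes.\<close>

lemma excess_strict_mono:
  fixes a r rs w w' :: real
  defines "n \<equiv> \<lambda>w. max (2 * (w - rs)) (1 - r + (1 + a) * w - w\<^sup>2 / 2)"
    and "e \<equiv> \<lambda>w. 1 - r - 2 * a + 2 * w"
  assumes w: "w < w'" "w' \<le> a" and "0 \<le> e w" "2 * rs < w"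
  shows "n w * e w - w\<^sup>2 < n w' * e w' - w'\<^sup>2"
proof -
  have "0 \<le> (w' - w) * (1 + (a - w') / 2 + (a - w) / 2)"
    using w by simp
  then have "n w \<le> n w'"
    using w unfolding n_def by (intro max.mono) (auto simp: power2_eq_square field_simps)
  then have "0 \<le> e w * (n w' - n w)" using assms by simp
  moreover have "2 * (w' - rs) \<le> n w'" by (simp add: n_def)
  then have "0 < (w' - w) * (2 * n w' - w - w')"
    using w \<open>2 * rs < w\<close> by (intro mult_pos_pos) auto
  moreover have "(n w' * e w' - w'\<^sup>2) - (n w * e w - w\<^sup>2) = e w * (n w' - n w) + (w' - w) * (2 * n w' - w - w')"
    by (simp add: e_def power2_eq_square algebra_simps)
  ultimately show ?thesis by linarith
qed

text \<open>With \<open>x = p2 - rs\<close>, the excess \<open>F t x\<close> is strictly decreasing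
  on \<open>{0..b}\<close> and changes sign there. Its unique root is continuous in \<open>t\<close>
  by \<open>root_continuous\<close>.\<close>

lemma equilibrium_branch_exists:
  fixes s r \<delta> :: real
  assumes s: "(499/1000)\<^sup>2 / 2 \<le> s" and r: "0 < r" "r < 1 - reservation s 0 / 2"
    and \<delta>: "0 < \<delta>" "s + \<delta> < 1/8" "4 * \<delta> < r" "4 * \<delta> < 2 * (1 - r) - reservation s 0"
  shows "\<exists>q. equilibrium_branch s r \<delta> q"
proof -
  define a where "a = reservation s"
  define n where "n t x = max (2 * (a t - x - t)) (1 - r + (1 + a t) * (a t - x) - (a t - x)\<^sup>2 / 2)" for t x
  define F where "F t x = n t x * (1 - r - 2 * x) - (a t - x)\<^sup>2" for t x
  define b where "b = (1 - r) / 2"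
  have a: "1/2 < a t" "a t \<le> 501/1000" "a t \<le> a 0" if "t \<in> {0..\<delta>}" for t
    using reservation_bounds[OF s, of t] reservation_antimono[of 0 t s] \<delta> that by (auto simp: a_def)
  have b: "0 \<le> b" "b < 1/2 - 2 * \<delta>"
    using r a[of 0] \<delta> by (auto simp: b_def a_def)
  have cont_a: "continuous_on T a" for T unfolding a_def by (rule continuous_on_reservation)
  have cont_a2: "continuous_on T (\<lambda>z. a (f z))" if "continuous_on T f" for T and f :: "'b::topological_space \<Rightarrow> real"
    using continuous_on_compose2[OF cont_a that, of UNIV] by simp
  have cont_F: "continuous_on T (\<lambda>(t, x). F t x)" for T
    unfolding F_def n_def split_beta by (intro continuous_intros cont_a2) auto
  have mono: "F t x' < F t x" if "t \<in> {0..\<delta>}" "0 \<le> x" "x < x'" "x' \<le> b" for t x x'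
  proof -
    have "2 * t < a t - x'" using that a[of t] b by auto
    moreover have "0 \<le> 1 - r - 2 * a t + 2 * (a t - x')" using that by (simp add: b_def)
    ultimately have "n t x' * (1 - r - 2 * a t + 2 * (a t - x')) - (a t - x')\<^sup>2
        < n t x * (1 - r - 2 * a t + 2 * (a t - x)) - (a t - x)\<^sup>2"
      unfolding n_def using that by (intro excess_strict_mono) auto
    moreover have "1 - r - 2 * a t + 2 * (a t - z) = 1 - r - 2 * z" for z by simp
    ultimately show ?thesis by (simp only: F_def)
  qed
  have "\<exists>x\<in>{0..b}. F t x = 0" if t: "t \<in> {0..\<delta>}" for t
  proof -
    have "1 - r - 2 * b = 0" by (simp add: b_def)
    then have "F t b \<le> 0" unfolding F_def by simp
    \<comment> \<open>Here \<open>F t 0 \<ge> 2 * (a t - t) * (1 - r) - (a t)\<^sup>2\<close>, and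
      the last bound on \<open>\<delta>\<close> absorbs the loss from \<open>t\<close>.\<close>
    moreover have "0 \<le> F t 0"
    proof -
      have "a t * (4 * \<delta>) \<le> a t * (2 * (1 - r) - a 0)"
        using a[OF t] \<delta> by (intro mult_left_mono) (auto simp: a_def)
      moreover have "a t * a t \<le> a t * a 0" using a[OF t] by (intro mult_left_mono) auto
      moreover have "t * (1 - r) \<le> \<delta> * 1" using t r \<delta> b by (intro mult_mono) (auto simp: b_def)
      moreover have "1/2 * \<delta> \<le> a t * \<delta>" using a[OF t] \<delta> by (intro mult_right_mono) auto
      moreover have "2 * (a t - t) * (1 - r) \<le> n t 0 * (1 - r)"
        using b by (intro mult_right_mono) (auto simp: n_def b_def)
      ultimately show ?thesis by (simp add: F_def power2_eq_square algebra_simps)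
    qed
    moreover have "continuous_on {0..b} (F t)"
      using continuous_on_compose2[OF cont_F[of UNIV], of "{0..b}" "\<lambda>x. (t, x)"]
      by (simp add: continuous_on_Pair)
    ultimately show ?thesis using IVT2'[of "F t" b 0 0] b by auto
  qed
  then obtain g where g: "\<And>t. t \<in> {0..\<delta>} \<Longrightarrow> g t \<in> {0..b}" "\<And>t. t \<in> {0..\<delta>} \<Longrightarrow> F t (g t) = 0"
    by metis
  have cont_g: "continuous_on {0..\<delta>} g"
  proof (rule root_continuous[of "{0..b}" _ F])
    show "F t x = 0 \<longleftrightarrow> x = g t" if "t \<in> {0..\<delta>}" "x \<in> {0..b}" for t x
      using mono[of t x "g t"] mono[of t "g t" x] g[of t] that by (cases "x = g t") fastforce+
  qed (use g cont_F in auto)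
  \<comment> \<open>The price of Firm 1 is recovered from \<open>n = 2 * m\<close>; the corner term
    in \<open>n\<close> keeps it nonnegative.\<close>
  define q where "q t = (n t (g t) / 2 - a t + g t + t, g t + t)" for t
  have "is_equilibrium s r t (q t)" if t: "t \<in> {0..\<delta>}" for t
  proof -
    have n: "2 * (a t - g t - t) \<le> n t (g t)" by (simp add: n_def)
    then have m: "0 < n t (g t)" using a[OF t] b g[OF t] t by auto
    have "0 \<le> n t (g t) / 2 - a t + g t + t" "0 \<le> g t + t" using n g[OF t] t by auto
    moreover have "n t (g t) * (1 - r - 2 * a t + 2 * (a t - (g t + t) + t)) = (a t - (g t + t) + t)\<^sup>2"
    proof -
      have "1 - r - 2 * a t + 2 * (a t - (g t + t) + t) = 1 - r - 2 * g t" by simp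
      moreover have "a t - (g t + t) + t = a t - g t" by simp
      ultimately show ?thesis using g(2)[OF t] by (simp only: F_def)
    qed
    moreover have "2 * (a t + (n t (g t) / 2 - a t + g t + t) - (g t + t)) = n t (g t)" by simp
    moreover have "a t - (g t + t) + t = a t - g t" by simp
    ultimately show ?thesis
      unfolding q_def using m
      by (subst equilibrium_iff; simp only: a_def[symmetric]) (auto simp: n_def)
  qed
  moreover have "continuous_on {0..\<delta>} q"
    unfolding q_def n_def by (intro continuous_intros cont_g cont_a) auto
  moreover have "q 0 \<in> {0..b} \<times> {0..b}"
  proof -
    have z: "0 \<in> {0..\<delta>}" using \<delta> by simp
    have "0 \<le> (a 0 - g 0) * (1 - a 0) + (a 0 - g 0)\<^sup>2 / 2"
      using a[OF z] g[OF z] b \<delta> by simp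
    then have "1 - r + (1 + a 0) * (a 0 - g 0) - (a 0 - g 0)\<^sup>2 / 2 \<le> 2 * (a 0 - g 0) + (1 - r)"
      by (simp add: algebra_simps)
    then have "n 0 (g 0) \<le> 2 * (a 0 - g 0) + (1 - r)"
      using b by (simp add: n_def b_def)
    moreover have "2 * (a 0 - g 0) \<le> n 0 (g 0)" by (simp add: n_def)
    ultimately show ?thesis using g[OF z] by (auto simp: q_def b_def)
  qed
  ultimately show ?thesis
    unfolding equilibrium_branch_def b_def[symmetric] by (intro exI[of _ q]) simp
qed

section \<open>Growth of the fee along every branch\<close>

text \<open>The derivative of the fee relative to \<open>S\<close> is \<open>fee_slope\<close>.
  Since 0 is a limit point of \<open>S\<close>, there are points of \<open>S\<close> so close to 0
  that its sign decides.\<close>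

lemma fee_increases:
  fixes F a w m :: "real \<Rightarrow> real"
  assumes der: "(a has_real_derivative a') (at 0 within S)"
      "(w has_real_derivative w') (at 0 within S)" "(m has_real_derivative m') (at 0 within S)"
    and F: "\<And>t. t \<in> S \<Longrightarrow> F t =
      (m t - w t + r) * (1 - m t + a t * w t - (w t)\<^sup>2 / 2) - (r - t) * (1 - m t) - (a t - w t + r)\<^sup>2 * m t"
    and pos: "0 < fee_slope r (a 0) (w 0) (m 0) a' w' m'"
    and S: "S \<subseteq> {0..}" "0 \<in> S" "0 islimpt S"
  shows "\<exists>t\<in>S. 0 < t \<and> F 0 < F t"
proof -
  define f where "f t = (m t - w t + r) * (1 - m t + a t * w t - (w t)\<^sup>2 / 2)
    - (r - t) * (1 - m t) - (a t - w t + r)\<^sup>2 * m t" for t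
  have "(f has_real_derivative fee_slope r (a 0) (w 0) (m 0) a' w' m') (at 0 within S)"
    unfolding f_def fee_slope_def
    by (rule derivative_eq_intros der refl | simp)+ (simp add: field_simps power2_eq_square)
  from has_real_derivative_pos_inc_right[OF this pos]
  obtain d where d: "0 < d" "\<And>h. 0 < h \<Longrightarrow> h \<in> S \<Longrightarrow> h < d \<Longrightarrow> f 0 < f h"
    by auto
  from S(3) \<open>0 < d\<close> obtain t where "t \<in> S" "t \<noteq> 0" "dist t 0 < d"
    unfolding islimpt_approachable by blast
  then show ?thesis using S(1,2) d(2)[of t] F by (intro bexI[of _ t]) (auto simp: f_def)
qed

lemma ad_fee_increases_on_branch:
  fixes s r \<delta> :: real
  assumes s: "(499/1000)\<^sup>2 / 2 \<le> s" and r: "0 < r" "r < 1 - reservation s 0 / 2"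
    and \<delta>: "0 < \<delta>" "s + \<delta> < 1/8"
    and q: "equilibrium_branch s r \<delta> q"
  shows "\<exists>rs\<in>{0<..\<delta>}. ad_fee s r 0 (q 0) < ad_fee s r rs (q rs)"
proof -
  define a where "a = reservation s"
  define p1 p2 where "p1 t = fst (q t)" and "p2 t = snd (q t)" for t
  define w m e where "w t = a t - p2 t + t" and "m t = a t + p1 t - p2 t"
    and "e t = 1 - r - 2 * a t + 2 * w t" for t
  have q_eq: "q t = (p1 t, p2 t)" for t by (simp add: p1_def p2_def)
  have cont_q: "continuous_on {0..\<delta>} q"
    and eq: "\<And>t. t \<in> {0..\<delta>} \<Longrightarrow> is_equilibrium s r t (p1 t, p2 t)"
    using q by (auto simp: equilibrium_branch_def q_eq[symmetric])
  have "(p1 0, p2 0) \<in> {0..(1 - r) / 2} \<times> {0..(1 - r) / 2}"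
    using q by (simp add: equilibrium_branch_def q_eq[symmetric])
  then have box: "0 \<le> p1 0" "0 \<le> p2 0" "p2 0 \<le> (1 - r) / 2" by auto
  have cont: "continuous_on {0..\<delta>} p1" "continuous_on {0..\<delta>} p2" "continuous_on {0..\<delta>} a"
    unfolding p1_def p2_def a_def by (intro continuous_intros cont_q)+
  have cont_wm: "continuous_on {0..\<delta>} w" "continuous_on {0..\<delta>} m" "continuous_on {0..\<delta>} e"
    unfolding w_def m_def e_def by (intro continuous_intros cont)+
  have p: "0 \<le> p1 t" "0 \<le> p2 t" if "t \<in> {0..\<delta>}" for t
    using eq[OF that] by (auto simp: is_equilibrium_def)
  have foc: "2 * m t = max (2 * (w t - t)) (1 - r + (1 + a t) * w t - (w t)\<^sup>2 / 2) \<and>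
      2 * m t * e t \<le> (w t)\<^sup>2 \<and> (p2 t = 0 \<or> 2 * m t * e t = (w t)\<^sup>2)"
    if "t \<in> {0..\<delta>}" "0 < m t" for t
    using equilibrium_iff[of "p1 t" "p2 t" s t r] eq[of t] p[of t] that
    unfolding a_def m_def w_def e_def by auto
  have a0: "1/2 < a 0" "a 0 \<le> 501/1000"
    using reservation_bounds[OF s, of 0] \<delta> by (auto simp: a_def)
  have z: "0 \<in> {0..\<delta>}" using \<delta> by simp
  have m0: "0 < m 0" using a0 box r by (simp add: m_def)
  \<comment> \<open>At \<open>p2 = 0\<close> optimality would give
    \<open>2 * (a 0 + p1 0) * (1 - r) \<le> (a 0)\<^sup>2\<close>, against
    \<open>a 0 < 2 * (1 - r)\<close>.\<close>
  have p20: "0 < p2 0"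
  proof (rule ccontr)
    assume "\<not> ?thesis"
    then have "p2 0 = 0" using box by simp
    then have "m 0 = a 0 + p1 0" "e 0 = 1 - r" "w 0 = a 0"
      by (simp_all add: m_def w_def e_def)
    moreover have "2 * m 0 * e 0 \<le> (w 0)\<^sup>2" using foc[OF z m0] by blast
    ultimately have "2 * (a 0 + p1 0) * (1 - r) \<le> (a 0)\<^sup>2" by (simp only:)
    moreover have "(a 0 + p1 0) * (2 * (1 - r)) \<ge> a 0 * (2 * (1 - r))"
      using a0 box r by (intro mult_right_mono) (auto simp: a_def)
    moreover have "a 0 * (2 * (1 - r)) > a 0 * a 0"
      using a0 r by (intro mult_strict_left_mono) (auto simp: a_def)
    ultimately show False by (simp add: power2_eq_square algebra_simps)
  qed
  have "(p2 \<longlongrightarrow> p2 0) (at 0 within {0..\<delta>})" "(m \<longlongrightarrow> m 0) (at 0 within {0..\<delta>})"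
    using cont cont_wm z by (auto simp: continuous_on_def)
  then have "\<forall>\<^sub>F t in at 0 within {0..\<delta>}. 0 < p2 t \<and> 0 < m t"
    using p20 m0 by (intro eventually_conj order_tendstoD)
  then obtain d where d: "0 < d" "\<And>t. t \<in> {0..\<delta>} \<Longrightarrow> t < d \<Longrightarrow> 0 < p2 t \<and> 0 < m t"
    unfolding eventually_at using p20 m0 by (metis atLeastAtMost_iff dist_0_norm dist_commute real_norm_def abs_of_nonneg)
  define T where "T = {0..min \<delta> (d / 2)}"
  have T: "T \<subseteq> {0..\<delta>}" "0 \<in> T" "closed T" using \<delta> d(1) by (auto simp: T_def)
  have "0 islimpt T"
    unfolding T_def using \<delta> d(1) by (simp add: islimpt_Icc)
  have foc': "2 * m t = max (2 * (w t - t)) (1 - r + (1 + a t) * w t - (w t)\<^sup>2 / 2)"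
      "2 * m t * e t = (w t)\<^sup>2" if "t \<in> T" for t
    using foc[of t] d(2)[of t] d(1) that by (auto simp: T_def)
  have fee: "ad_fee s r t (q t) = (m t - w t + r) * (1 - m t + a t * w t - (w t)\<^sup>2 / 2)
      - (r - t) * (1 - m t) - (a t - w t + r)\<^sup>2 * m t" if "t \<in> T" for t
    unfolding q_eq using foc'(2)[OF that] unfolding m_def w_def e_def a_def by (rule ad_fee_equilibrium)
  have w0: "0 < w 0" "w 0 \<le> a 0" "w 0 \<le> m 0"
    using box a0 r by (auto simp: w_def m_def)
  have a': "(a has_real_derivative - 1 / (1 - a 0)) (at 0 within S)" for S
    unfolding a_def using s by (intro reservation_has_derivative) (auto simp: power2_eq_square)
  have lim: "(f \<longlongrightarrow> f 0) (at 0 within S)" if "continuous_on {0..\<delta>} f" "S \<subseteq> T" for f :: "real \<Rightarrow> real" and S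
    using that T z by (meson continuous_on_def subset_trans tendsto_within_subset)
  \<comment> \<open>\<open>Si\<close>: Firm 1's price is interior (or its first-order condition holds at the corner);
    \<open>Sc\<close>: Firm 1's price is zero.\<close>
  define Si Sc where "Si = {t \<in> T. 2 * m t = 1 - r + (1 + a t) * w t - (w t)\<^sup>2 / 2}"
    and "Sc = {t \<in> T. 2 * m t = 2 * (w t - t)}"
  have "T = Si \<union> Sc" using foc'(1) by (auto simp: Si_def Sc_def max_def split: if_splits)
  then have "0 islimpt Si \<or> 0 islimpt Sc" using \<open>0 islimpt T\<close> by (simp add: islimpt_Un)
  \<comment> \<open>Closedness puts the limit point 0 into the set, so the equation of the regime
    also holds at \<open>rs = 0\<close>.\<close>
  moreover have "closed Si" "closed Sc"
  proof -
    note [continuous_intros] = cont(3)[THEN continuous_on_subset, OF T(1)]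
      cont_wm[THEN continuous_on_subset, OF T(1)]
    have "Si = T \<inter> (\<lambda>t. 2 * m t - (1 - r + (1 + a t) * w t - (w t)\<^sup>2 / 2)) -` {0}"
      by (auto simp: Si_def)
    also have "closed \<dots>"
      using T(3) by (intro continuous_closed_preimage continuous_intros) auto
    finally show "closed Si" .
    have "Sc = T \<inter> (\<lambda>t. 2 * m t - 2 * (w t - t)) -` {0}"
      by (auto simp: Sc_def)
    also have "closed \<dots>"
      using T(3) by (intro continuous_closed_preimage continuous_intros) auto
    finally show "closed Sc" .
  qed
  ultimately have "0 islimpt Si \<and> 0 \<in> Si \<or> 0 islimpt Sc \<and> 0 \<in> Sc"
    by (auto simp: closed_limpt)
  then have "\<exists>t\<in>T. 0 < t \<and> ad_fee s r 0 (q 0) < ad_fee s r t (q t)"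
  proof (elim disjE conjE)
    assume S: "0 islimpt Si" "0 \<in> Si"
    have sub: "Si \<subseteq> T" by (auto simp: Si_def)
    define n where "n t = 1 - r + (1 + a t) * w t - (w t)\<^sup>2 / 2" for t
    have n: "2 * m t = n t" if "t \<in> Si" for t using that by (simp add: Si_def n_def)
    have e0: "0 < e 0"
      using foc'(2)[OF T(2)] w0 m0 by (metis mult_pos_pos zero_less_mult_pos zero_less_numeral zero_less_power)
    define B where "B = e 0 * (1 + a 0 - w 0) + 2 * n 0 - 2 * w 0"
    have B: "0 < B"
    proof -
      have "0 < e 0 * (1 + a 0 - w 0)" using e0 w0 by simp
      then show ?thesis using n[OF S(2)] w0 by (simp add: B_def)
    qed
    \<comment> \<open>In terms of \<open>a\<close> and \<open>w\<close> alone, the equation is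
      \<open>n * e = w\<^sup>2\<close>. Its partial derivatives at 0 are
      \<open>e 0 * w 0 - 2 * n 0\<close> in \<open>a\<close> and \<open>B\<close> in
      \<open>w\<close>; the explicit \<open>rs\<close>-part is 0.\<close>
    define w' where "w' = - (0 + (- 1 / (1 - a 0)) * (e 0 * w 0 - 2 * n 0)) / B"
    have "(w has_real_derivative w') (at 0 within Si)"
      unfolding w'_def
    proof (rule implicit_derivative[OF a'])
      show "((\<lambda>t. e t * w t - 2 * n 0) \<longlongrightarrow> e 0 * w 0 - 2 * n 0) (at 0 within Si)"
        by (intro tendsto_intros lim cont_wm sub)
      have "((\<lambda>t. e t * (1 + a 0 - (w t + w 0) / 2) + 2 * n 0 - (w t + w 0)) \<longlongrightarrow>
          e 0 * (1 + a 0 - (w 0 + w 0) / 2) + 2 * n 0 - (w 0 + w 0)) (at 0 within Si)"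
        by (intro tendsto_intros lim cont_wm sub) auto
      then show "((\<lambda>t. e t * (1 + a 0 - (w t + w 0) / 2) + 2 * n 0 - (w t + w 0)) \<longlongrightarrow> B) (at 0 within Si)"
        by (simp add: B_def)
      show "((\<lambda>t. 0) \<longlongrightarrow> 0) (at 0 within Si)" by simp
      show "B \<noteq> 0" using B by simp
      fix t assume "t \<in> Si"
      then have 1: "n t * e t = (w t)\<^sup>2" "n 0 * e 0 = (w 0)\<^sup>2"
        using foc'(2)[of t] foc'(2)[OF T(2)] n[of t] n[OF S(2)] sub by auto
      have "(t - 0) * 0 + (a t - a 0) * (e t * w t - 2 * n 0)
          + (w t - w 0) * (e t * (1 + a 0 - (w t + w 0) / 2) + 2 * n 0 - (w t + w 0))
          = e t * (n t - n 0) + n 0 * (e t - e 0) - ((w t)\<^sup>2 - (w 0)\<^sup>2)"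
        by (simp add: n_def e_def power2_eq_square field_simps)
      also have "\<dots> = (n t * e t - (w t)\<^sup>2) - (n 0 * e 0 - (w 0)\<^sup>2)"
        by (simp add: algebra_simps)
      finally show "(t - 0) * 0 + (a t - a 0) * (e t * w t - 2 * n 0)
          + (w t - w 0) * (e t * (1 + a 0 - (w t + w 0) / 2) + 2 * n 0 - (w t + w 0)) = 0"
        by (simp add: 1)
    qed
    note w' = this
    have n': "((\<lambda>t. n t / 2) has_real_derivative
        ((1 + a 0 - w 0) * w' + w 0 * (- 1 / (1 - a 0))) / 2) (at 0 within Si)"
      unfolding n_def
      by (rule derivative_eq_intros a' w' refl | simp)+ (simp add: algebra_simps)
    have "\<exists>t\<in>Si. 0 < t \<and> ad_fee s r 0 (q 0) < ad_fee s r t (q t)"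
    proof (rule fee_increases[OF a' w' n'])
      show "ad_fee s r t (q t) = (n t / 2 - w t + r) * (1 - n t / 2 + a t * w t - (w t)\<^sup>2 / 2)
          - (r - t) * (1 - n t / 2) - (a t - w t + r)\<^sup>2 * (n t / 2)" if "t \<in> Si" for t
      proof -
        have "n t / 2 = m t" using n[OF that] by simp
        then show ?thesis using fee[of t] sub that by (simp only: subset_iff)
      qed
      have m_n: "n 0 / 2 = m 0" using n[OF S(2)] by simp
      show "0 < fee_slope r (a 0) (w 0) (n 0 / 2) (- 1 / (1 - a 0)) w'
          (((1 + a 0 - w 0) * w' + w 0 * (- 1 / (1 - a 0))) / 2)"
        unfolding m_n
      proof (rule fee_slope_interior_pos[where e = "e 0"])
        show "w' * (e 0 * (1 + a 0 - w 0) + 4 * m 0 - 2 * w 0) = - 1 / (1 - a 0) * (4 * m 0 - e 0 * w 0)"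
        proof -
          have "w' * B = - (0 + c * (e 0 * w 0 - 2 * n 0))" if "c = - 1 / (1 - a 0)" for c
            using B by (simp add: w'_def that)
          then have "w' * B = - 1 / (1 - a 0) * (2 * n 0 - e 0 * w 0)"
            by (simp only: minus_mult_right minus_diff_eq add_0)
          moreover have "B = e 0 * (1 + a 0 - w 0) + 4 * m 0 - 2 * w 0" "2 * n 0 = 4 * m 0"
            using n[OF S(2)] by (simp_all add: B_def)
          ultimately show ?thesis by (simp only:)
        qed
      qed (use a0 w0 foc'(2)[OF T(2)] n[OF S(2)] in \<open>simp_all add: n_def e_def\<close>)
      show "Si \<subseteq> {0..}" using sub T(1) by auto
    qed (use S in auto)
    then show ?thesis using sub by blast
  next
    assume S: "0 islimpt Sc" "0 \<in> Sc"
    have sub: "Sc \<subseteq> T" by (auto simp: Sc_def)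
    have m: "m t = w t - t" if "t \<in> Sc" for t using that by (simp add: Sc_def)
    have e0: "e 0 = w 0 / 2"
      using foc'(2)[OF T(2)] w0 m[OF S(2)] by (simp add: power2_eq_square)
    define a'0 where "a'0 = - 1 / (1 - a 0)"
    \<comment> \<open>Now the equation is \<open>2 * (w - rs) * e = w\<^sup>2\<close>, where
      \<open>rs\<close> occurs explicitly and contributes \<open>- 2 * e 0\<close>.\<close>
    have "(w has_real_derivative - (- 2 * e 0 + a'0 * (- 4 * w 0)) / (2 * e 0 + 2 * w 0)) (at 0 within Sc)"
      unfolding a'0_def
    proof (rule implicit_derivative[OF a'])
      show "((\<lambda>t. - 2 * e t) \<longlongrightarrow> - 2 * e 0) (at 0 within Sc)"
        by (intro tendsto_intros lim cont_wm sub)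
      show "((\<lambda>t. - 4 * w 0) \<longlongrightarrow> - 4 * w 0) (at 0 within Sc)" by simp
      have "((\<lambda>t. 2 * e t + 4 * w 0 - (w t + w 0)) \<longlongrightarrow> 2 * e 0 + 4 * w 0 - (w 0 + w 0)) (at 0 within Sc)"
        by (intro tendsto_intros lim cont_wm sub)
      then show "((\<lambda>t. 2 * e t + 4 * w 0 - (w t + w 0)) \<longlongrightarrow> 2 * e 0 + 2 * w 0) (at 0 within Sc)"
        by (simp add: add.commute)
      show "2 * e 0 + 2 * w 0 \<noteq> 0" using w0 e0 by simp
      fix t assume "t \<in> Sc"
      then have 1: "2 * (w t - t) * e t = (w t)\<^sup>2" "2 * w 0 * e 0 = (w 0)\<^sup>2"
        using foc'(2)[of t] foc'(2)[OF T(2)] m[of t] m[OF S(2)] sub by auto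
      have "(t - 0) * (- 2 * e t) + (a t - a 0) * (- 4 * w 0) + (w t - w 0) * (2 * e t + 4 * w 0 - (w t + w 0))
          = 2 * (w t - w 0 - t) * e t + 2 * w 0 * (e t - e 0) - ((w t)\<^sup>2 - (w 0)\<^sup>2)"
        by (simp add: e_def power2_eq_square algebra_simps)
      also have "\<dots> = (2 * (w t - t) * e t - (w t)\<^sup>2) - (2 * w 0 * e 0 - (w 0)\<^sup>2)"
        by (simp add: algebra_simps)
      finally show "(t - 0) * (- 2 * e t) + (a t - a 0) * (- 4 * w 0)
          + (w t - w 0) * (2 * e t + 4 * w 0 - (w t + w 0)) = 0"
        unfolding 1 by simp
    qed
    also have "- (- 2 * e 0 + a'0 * (- 4 * w 0)) / (2 * e 0 + 2 * w 0) = (1 + 4 * a'0) / 3"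
      using w0 by (simp add: e0 field_simps)
    finally have w': "(w has_real_derivative (1 + 4 * a'0) / 3) (at 0 within Sc)" .
    have m': "((\<lambda>t. w t - t) has_real_derivative (1 + 4 * a'0) / 3 - 1) (at 0 within Sc)"
      by (intro derivative_intros w')
    have "\<exists>t\<in>Sc. 0 < t \<and> ad_fee s r 0 (q 0) < ad_fee s r t (q t)"
    proof (rule fee_increases[OF a'[folded a'0_def] w' m'])
      show "ad_fee s r t (q t) = (w t - t - w t + r) * (1 - (w t - t) + a t * w t - (w t)\<^sup>2 / 2)
          - (r - t) * (1 - (w t - t)) - (a t - w t + r)\<^sup>2 * (w t - t)" if "t \<in> Sc" for t
        using fee[of t] m[OF that] sub that by auto
      have "0 < fee_slope r (a 0) (w 0) (w 0) a'0 ((1 + 4 * a'0) / 3) ((1 + 4 * a'0) / 3 - 1)"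
        using a0 w0 foc'(2)[OF T(2)] m[OF S(2)]
        by (intro fee_slope_corner_pos) (auto simp: a'0_def e_def)
      then show "0 < fee_slope r (a 0) (w 0) (w 0 - 0) a'0 ((1 + 4 * a'0) / 3) ((1 + 4 * a'0) / 3 - 1)"
        by simp
      show "Sc \<subseteq> {0..}" using sub T(1) by auto
    qed (use S in auto)
    then show ?thesis using sub by blast
  qed
  then show ?thesis using T(1) by force
qed

text \<open>Existence of a branch is asserted separately, so the claim about all branches is not
  vacuous.\<close>

theorem proposition7:
  shows "\<exists>s0\<in>{0<..<1/8}. \<forall>s\<in>{s0..<1/8}. \<forall>r\<in>{0<..<rbar (reservation s 0)}.
           \<exists>\<delta>. 0 < \<delta> \<and> \<delta> \<le> r \<and> s + \<delta> < 1/8 \<and>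
             (\<exists>q. equilibrium_branch s r \<delta> q) \<and>
             (\<forall>q. equilibrium_branch s r \<delta> q \<longrightarrow>
                (\<exists>rs\<in>{0<..\<delta>}. ad_fee s r 0 (q 0) < ad_fee s r rs (q rs)))"
\<comment> \<open>This threshold is the \<open>s\<close> with
  \<open>sqrt (2 * s) = 499/1000\<close>, which gives \<open>a \<le> 501/1000\<close>.\<close>
proof (intro bexI[of _ "(499/1000)\<^sup>2 / 2"] ballI)
  fix s r :: real
  assume s: "s \<in> {(499/1000)\<^sup>2 / 2..<1/8}" and r: "r \<in> {0<..<rbar (reservation s 0)}"
  have "1/2 < reservation s 0" "reservation s 0 \<le> 501/1000"
    using reservation_bounds[of s 0] s by auto
  then have r1: "r < 1 - reservation s 0 / 2"
    using rbar_less[of "reservation s 0"] r by auto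
  \<comment> \<open>Dividing by 2 and 5 makes the inequalities for \<open>\<delta>\<close>
    strict.\<close>
  define \<delta> where "\<delta> = Min {(1/8 - s) / 2, r / 5, (2 * (1 - r) - reservation s 0) / 5}"
  have "0 < \<delta>" using s r r1 by (simp add: \<delta>_def)
  moreover have "\<delta> \<le> (1/8 - s) / 2" "\<delta> \<le> r / 5" "\<delta> \<le> (2 * (1 - r) - reservation s 0) / 5"
    unfolding \<delta>_def by (intro Min_le; simp)+
  ultimately have \<delta>: "0 < \<delta>" "s + \<delta> < 1/8" "4 * \<delta> < r" "4 * \<delta> < 2 * (1 - r) - reservation s 0" "\<delta> \<le> r"
    using s r by auto
  show "\<exists>\<delta>. 0 < \<delta> \<and> \<delta> \<le> r \<and> s + \<delta> < 1/8 \<and>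
             (\<exists>q. equilibrium_branch s r \<delta> q) \<and>
             (\<forall>q. equilibrium_branch s r \<delta> q \<longrightarrow>
                (\<exists>rs\<in>{0<..\<delta>}. ad_fee s r 0 (q 0) < ad_fee s r rs (q rs)))"
    using equilibrium_branch_exists[of s r \<delta>] ad_fee_increases_on_branch[of s r \<delta>] s r r1 \<delta>
    by (intro exI[of _ \<delta>]) auto
qed (auto simp: power2_eq_square)

end
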